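(* Let $I \subseteq \mathbb{R}$ be an interval with interior $I^{\circ}$, let $f: I \to \mathbb{R}$ be three times differentiable on $I^{\circ}$, let $a,b \in I^{\circ}$ with $a<b$, and suppose $f''' \in L[a,b]$. Let $p>1$ and $q=\frac{p}{p-1}$. If $|f'''|^{\frac{p}{p-1}}$ is quasi-convex on $[a,b]$, then $$\left| f\left(\frac{a+b}{2}\right) - \frac{1}{b-a}\int_a^b f(x)\,dx + \frac{b-a}{24}\,[f'(b)-f'(a)] \right| \le \frac{(b-a)^3}{96}\left(\frac{1}{p+1}\right)^{\frac1p}\left(\max\{|f'''(a)|^q,|f'''(b)|^q\}\right)^{\frac1q}.$$
   Context: A function $g:[a,b]\to\mathbb{R}$ is called quasi-convex on $[a,b]$ if $g(\lambda x+(1-\lambda)y)\le \max\{g(x),g(y)\}$ for all $x,y\in[a,b]$ and all $\lambda\in[0,1]$. $L[a,b]$ denotes the Lebesgue integrable functions on $[a,b]$. *)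

theory Defs
  imports "HOL-Analysis.Analysis"
begin

definition quasi_convex_on :: "real set \<Rightarrow> (real \<Rightarrow> real) \<Rightarrow> bool" where
  "quasi_convex_on S g \<longleftrightarrow>
     (\<forall>x\<in>S. \<forall>y\<in>S. \<forall>t\<in>{0..1}. g (t * x + (1 - t) * y) \<le> max (g x) (g y))"

text \<open>
  The library \<open>deriv\<close> is a total operator whose value at a point of an open set
  depends only on the function near that point, so on an open set \<open>S\<close> the
  functions \<open>(deriv ^^ k) f\<close> are the successive derivatives of \<open>f\<close>, whatever
  the values of \<open>f\<close> outside \<open>S\<close>. The definition is intended for open \<open>S\<close> only.
\<close>

definition times_differentiable_on :: "nat \<Rightarrow> (real \<Rightarrow> real) \<Rightarrow> real set \<Rightarrow> bool" where
  "times_differentiable_on n f S \<longleftrightarrow> (\<forall>k<n. (deriv ^^ k) f differentiable_on S)"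

end

theory Submission
  imports Defs
begin

text \<open>
  Put \<open>m = (a + b) / 2\<close>, \<open>c = (b - a) / 2\<close> and
  \[\varphi(s) = 2 s f(m) - \int_{m-s}^{m+s} f + \frac{s^2}{6} (f'(m+s) - f'(m-s)),\]
  so that the left-hand side is \<open>\<bar>\<phi> c\<bar> / (2 c)\<close>. Quasi-convexity bounds \<open>\<bar>f'''\<bar>\<close> on \<open>[a, b]\<close> by
  the constant \<open>M\<close> given by its endpoint values. In \<open>\<phi>''\<close> the terms free of \<open>f'''\<close> form a function
  \<open>\<psi>\<close> with \<open>\<psi> 0 = 0\<close> and \<open>\<psi>' s = 2/3 s (f''' (m+s) - f''' (m-s))\<close>. Hence \<open>\<bar>\<psi> s\<bar> \<le> 2/3 M s^2\<close>,
  \<open>\<bar>\<phi>'' s\<bar> \<le> M s^2\<close> and, integrating twice, \<open>\<bar>\<phi> c\<bar> \<le> M c^4 / 12\<close>. This gives the bound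
  \<open>M (b - a)^3 / 192\<close>, which suffices since \<open>1 / 2 \<le> (1 / (p + 1)) powr (1 / p)\<close> for \<open>p \<ge> 1\<close>.
\<close>

text \<open>With \<open>h\<close> the antiderivative of the bound that vanishes at 0, both
  \<open>h - g\<close> and \<open>h + g\<close> have nonnegative derivative on \<open>[0, c]\<close>
  and start at 0. Arguing by monotonicity avoids integrating \<open>g'\<close>.\<close>

lemma abs_le_power_if_deriv_le_power:
  fixes g g' :: "real \<Rightarrow> real"
  assumes der: "\<And>s. \<lbrakk>0 \<le> s; s \<le> c\<rbrakk> \<Longrightarrow> (g has_real_derivative g' s) (at s)"
    and bound: "\<And>s. \<lbrakk>0 \<le> s; s \<le> c\<rbrakk> \<Longrightarrow> \<bar>g' s\<bar> \<le> k * s ^ n"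
    and "g 0 = 0" "0 \<le> s" "s \<le> c"
  shows "\<bar>g s\<bar> \<le> k * s ^ Suc n / Suc n"
proof -
  define h where "h x = k * x ^ Suc n / Suc n" for x :: real
  have h: "(h has_real_derivative k * x ^ n) (at x)" for x
    unfolding h_def by (auto intro!: derivative_eq_intros simp del: power_Suc)
  have "h 0 - g 0 \<le> h s - g s"
  proof (rule DERIV_nonneg_imp_nondecreasing[OF \<open>0 \<le> s\<close>])
    fix x assume "0 \<le> x" "x \<le> s"
    then show "\<exists>y. ((\<lambda>x. h x - g x) has_real_derivative y) (at x) \<and> 0 \<le> y"
      using DERIV_diff[OF h der, of x] bound[of x] \<open>s \<le> c\<close>
      by (intro exI[of _ "k * x ^ n - g' x"]) auto
  qed
  moreover have "h 0 + g 0 \<le> h s + g s"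
  proof (rule DERIV_nonneg_imp_nondecreasing[OF \<open>0 \<le> s\<close>])
    fix x assume "0 \<le> x" "x \<le> s"
    then show "\<exists>y. ((\<lambda>x. h x + g x) has_real_derivative y) (at x) \<and> 0 \<le> y"
      using DERIV_add[OF h der, of x] bound[of x] \<open>s \<le> c\<close>
      by (intro exI[of _ "k * x ^ n + g' x"]) auto
  qed
  ultimately have "\<bar>g s\<bar> \<le> h s"
    using \<open>g 0 = 0\<close> by (simp add: h_def)
  then show ?thesis
    by (simp add: h_def)
qed

text \<open>An antiderivative \<open>F\<close> stands for the integral, so only derivatives occur.
  The functions \<open>\<psi>\<close>, \<open>\<phi>1\<close> and \<open>\<phi>\<close> all vanish
  at 0 and are bounded in turn by the previous lemma, with exponents 1, 2 and 3.\<close>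

lemma symmetric_midpoint_bound:
  fixes F f f1 f2 f3 :: "real \<Rightarrow> real"
  assumes F: "\<And>x. x \<in> {m - c..m + c} \<Longrightarrow> (F has_real_derivative f x) (at x)"
    and f: "\<And>x. x \<in> {m - c..m + c} \<Longrightarrow> (f has_real_derivative f1 x) (at x)"
    and f1: "\<And>x. x \<in> {m - c..m + c} \<Longrightarrow> (f1 has_real_derivative f2 x) (at x)"
    and f2: "\<And>x. x \<in> {m - c..m + c} \<Longrightarrow> (f2 has_real_derivative f3 x) (at x)"
    and M: "\<And>x. x \<in> {m - c..m + c} \<Longrightarrow> \<bar>f3 x\<bar> \<le> M"
    and "0 \<le> c"
  shows "\<bar>2 * c * f m - (F (m + c) - F (m - c)) + c\<^sup>2 / 6 * (f1 (m + c) - f1 (m - c))\<bar> \<le> M * c ^ 4 / 12"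
proof -
  \<comment> \<open>\<open>\<phi>1\<close> is the derivative of \<open>\<phi>\<close>, and
    \<open>\<psi>\<close> is the part of the derivative of \<open>\<phi>1\<close> that is free of
    \<open>f3\<close>.\<close>
  define \<psi> where "\<psi> s = 2 / 3 * (s * (f2 (m + s) + f2 (m - s)) - (f1 (m + s) - f1 (m - s)))" for s
  define \<phi>1 where "\<phi>1 s = 2 * f m - (f (m + s) + f (m - s)) + s / 3 * (f1 (m + s) - f1 (m - s))
    + s\<^sup>2 / 6 * (f2 (m + s) + f2 (m - s))" for s
  define \<phi> where "\<phi> s = 2 * s * f m - (F (m + s) - F (m - s)) + s\<^sup>2 / 6 * (f1 (m + s) - f1 (m - s))" for s
  have shift: "((\<lambda>s. h (m + s)) has_real_derivative h' (m + s)) (at s)"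
      "((\<lambda>s. h (m - s)) has_real_derivative - h' (m - s)) (at s)"
    if "\<And>x. x \<in> {m - c..m + c} \<Longrightarrow> (h has_real_derivative h' x) (at x)" "0 \<le> s" "s \<le> c" for h h' s
  proof -
    have p: "(h has_real_derivative h' (m + s)) (at (m + s))"
      and n: "(h has_real_derivative h' (m - s)) (at (m - s))"
      using that by auto
    show "((\<lambda>s. h (m + s)) has_real_derivative h' (m + s)) (at s)"
      by (rule DERIV_chain2[where f = h and g = "\<lambda>s. m + s", OF p, THEN DERIV_cong]) (auto intro!: derivative_eq_intros)
    show "((\<lambda>s. h (m - s)) has_real_derivative - h' (m - s)) (at s)"
      by (rule DERIV_chain2[where f = h and g = "\<lambda>s. m - s", OF n, THEN DERIV_cong]) (auto intro!: derivative_eq_intros)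
  qed
  have diff_le: "\<bar>f3 (m + s) - f3 (m - s)\<bar> \<le> 2 * M" if "0 \<le> s" "s \<le> c" for s
    using M[of "m + s"] M[of "m - s"] that by auto
  have "\<bar>\<psi> s\<bar> \<le> 4 / 3 * M * s ^ Suc 1 / Suc 1" if "0 \<le> s" "s \<le> c" for s
  proof (rule abs_le_power_if_deriv_le_power[where c = c])
    fix s assume s: "0 \<le> s" "s \<le> c"
    show "(\<psi> has_real_derivative 2 / 3 * s * (f3 (m + s) - f3 (m - s))) (at s)"
      unfolding \<psi>_def
      \<comment> \<open>The \<open>f2\<close> terms cancel.
        \<open>zero_neq_numeral[symmetric]\<close> discharges the nonzero-denominator side
        conditions of the quotient rule.\<close>
      by (rule derivative_eq_intros refl zero_neq_numeral[symmetric] shift[OF f2 s] shift[OF f1 s] | assumption)+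
        (simp add: algebra_simps)
    show "\<bar>2 / 3 * s * (f3 (m + s) - f3 (m - s))\<bar> \<le> 4 / 3 * M * s ^ 1"
      using mult_left_mono[OF diff_le[OF s], of "2 / 3 * s"] s by (simp add: abs_mult)
  qed (use that in \<open>auto simp: \<psi>_def\<close>)
  then have \<psi>_le: "\<bar>\<psi> s\<bar> \<le> 2 / 3 * M * s\<^sup>2" if "0 \<le> s" "s \<le> c" for s
    using that by (fastforce simp: power2_eq_square)
  have \<phi>1_le: "\<bar>\<phi>1 s\<bar> \<le> M * s ^ Suc 2 / Suc 2" if "0 \<le> s" "s \<le> c" for s
  proof (rule abs_le_power_if_deriv_le_power[where c = c])
    fix s assume s: "0 \<le> s" "s \<le> c"
    show "(\<phi>1 has_real_derivative \<psi> s + s\<^sup>2 / 6 * (f3 (m + s) - f3 (m - s))) (at s)"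
      unfolding \<phi>1_def \<psi>_def
      by (rule derivative_eq_intros refl zero_neq_numeral[symmetric] shift[OF f s] shift[OF f2 s] shift[OF f1 s] | assumption)+
        (simp add: field_simps)
    have "\<bar>s\<^sup>2 / 6 * (f3 (m + s) - f3 (m - s))\<bar> \<le> s\<^sup>2 / 6 * (2 * M)"
      using mult_left_mono[OF diff_le[OF s], of "s\<^sup>2 / 6"] by (simp add: abs_mult)
    \<comment> \<open>The two summands contribute \<open>2 / 3\<close> and \<open>1 / 3\<close> of
      \<open>M * s\<^sup>2\<close>.\<close>
    then show "\<bar>\<psi> s + s\<^sup>2 / 6 * (f3 (m + s) - f3 (m - s))\<bar> \<le> M * s\<^sup>2"
      using \<psi>_le[OF s] by argo
  qed (use that in \<open>auto simp: \<phi>1_def\<close>)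
  have "\<bar>\<phi> c\<bar> \<le> M / 3 * c ^ Suc 3 / Suc 3"
  proof (rule abs_le_power_if_deriv_le_power[where c = c])
    fix s assume s: "0 \<le> s" "s \<le> c"
    show "(\<phi> has_real_derivative \<phi>1 s) (at s)"
      unfolding \<phi>_def \<phi>1_def
      by (rule derivative_eq_intros refl zero_neq_numeral[symmetric] shift[OF F s] shift[OF f1 s] | assumption)+
        (simp add: field_simps)
    show "\<bar>\<phi>1 s\<bar> \<le> M / 3 * s ^ 3"
      using \<phi>1_le[OF s] by (simp add: numeral_3_eq_3)
  qed (use \<open>0 \<le> c\<close> in \<open>auto simp: \<phi>_def\<close>)
  then show ?thesis
    by (simp add: \<phi>_def)
qed

text \<open>The symmetric bound with \<open>c = (b - a) / 2\<close>, divided by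
  \<open>2 * c = b - a\<close>: the weight \<open>c\<^sup>2 / 6\<close> becomes
  \<open>(b - a) / 24\<close>, and \<open>M * c ^ 4 / 12\<close> becomes
  \<open>M * (b - a) ^ 3 / 192\<close>.\<close>

lemma midpoint_corrected_bound:
  fixes f :: "real \<Rightarrow> real"
  assumes "open S" "{a..b} \<subseteq> S" "a < b"
    and "times_differentiable_on 3 f S"
    and M: "\<And>x. x \<in> {a..b} \<Longrightarrow> \<bar>(deriv ^^ 3) f x\<bar> \<le> M"
  shows "\<bar>f ((a + b) / 2) - 1 / (b - a) * integral {a..b} f + (b - a) / 24 * (deriv f b - deriv f a)\<bar>
    \<le> (b - a) ^ 3 / 192 * M"
proof -
  have der: "((deriv ^^ k) f has_real_derivative (deriv ^^ Suc k) f x) (at x)" if "k < 3" "x \<in> S" for k x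
    using assms(1,4) that
    by (auto simp: times_differentiable_on_def differentiable_on_eq_differentiable_at
        real_differentiableE DERIV_deriv_iff_real_differentiable)
  have "a \<in> S" "b \<in> S"
    using assms(2,3) by auto
  \<comment> \<open>\<open>F\<close> must have two-sided derivatives at \<open>a\<close> and
    \<open>b\<close> as well, so it is constructed on a larger interval inside \<open>S\<close> that
    has both points in its interior.\<close>
  then obtain d e where "d > 0" "cball a d \<subseteq> S" "e > 0" "cball b e \<subseteq> S"
    using \<open>open S\<close> by (meson open_contains_cball)
  define a' b' where "a' = a - d" and "b' = b + e"
  have lt: "a' < a" "b < b'"
    using \<open>d > 0\<close> \<open>e > 0\<close> by (simp_all add: a'_def b'_def)
  have sub: "{a'..b'} \<subseteq> S"
  proof
    fix x assume "x \<in> {a'..b'}"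
    then have "x \<in> cball a d \<or> x \<in> {a..b} \<or> x \<in> cball b e"
      by (auto simp: a'_def b'_def dist_real_def)
    then show "x \<in> S"
      using assms(2) \<open>cball a d \<subseteq> S\<close> \<open>cball b e \<subseteq> S\<close> by blast
  qed
  have "continuous_on {a'..b'} f"
    using der[of 0] sub
    by (auto intro!: continuous_at_imp_continuous_on DERIV_isCont)
  then obtain F where F': "\<And>x. x \<in> {a'..b'} \<Longrightarrow> (F has_vector_derivative f x) (at x within {a'..b'})"
    using antiderivative_continuous by blast
  have F: "(F has_real_derivative f x) (at x)" if "x \<in> {a..b}" for x
    using F'[of x] that lt at_within_Icc_at[of a' x b']
    by (simp add: has_real_derivative_iff_has_vector_derivative)
  have "(f has_integral F b - F a) {a..b}"
    using F \<open>a < b\<close>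
    by (intro fundamental_theorem_of_calculus)
      (auto simp: has_real_derivative_iff_has_vector_derivative intro: has_vector_derivative_at_within)
  then have int: "integral {a..b} f = F b - F a"
    by (rule integral_unique)
  define m c where "m = (a + b) / 2" and "c = (b - a) / 2"
  have mc: "m - c = a" "m + c = b"
    by (simp_all add: m_def c_def field_simps)
  have "c > 0"
    using \<open>a < b\<close> by (simp add: c_def)
  have "\<bar>2 * c * f m - (F (m + c) - F (m - c)) + c\<^sup>2 / 6 * (deriv f (m + c) - deriv f (m - c))\<bar>
      \<le> M * c ^ 4 / 12" (is "\<bar>?E\<bar> \<le> _")
    by (rule symmetric_midpoint_bound[where ?f2.0 = "(deriv ^^ 2) f" and ?f3.0 = "(deriv ^^ 3) f"])
      (use F der[of 0] der[of 1] der[of 2] M \<open>c > 0\<close> assms(2) in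
        \<open>auto simp: mc numeral_2_eq_2 numeral_3_eq_3\<close>)
  then have "\<bar>?E\<bar> / (2 * c) \<le> M * c ^ 4 / 12 / (2 * c)"
    using \<open>c > 0\<close> by (intro divide_right_mono) auto
  also have "\<dots> = (b - a) ^ 3 / 192 * M"
    using \<open>c > 0\<close> by (simp add: c_def field_simps power4_eq_xxxx power3_eq_cube)
  also have "\<bar>?E\<bar> / (2 * c) = \<bar>?E / (2 * c)\<bar>"
    using \<open>c > 0\<close> by simp
  also have "?E / (2 * c) = f m - 1 / (b - a) * integral {a..b} f + (b - a) / 24 * (deriv f b - deriv f a)"
    using \<open>a < b\<close> unfolding mc int by (simp add: c_def field_simps power2_eq_square)
  finally show ?thesis
    by (simp add: m_def)
qed

text \<open>Taking \<open>p\<close>-th powers reduces the claim to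
  \<open>p + 1 \<le> 2 powr p\<close>. This follows from \<open>1 + x \<le> exp x\<close> at
  \<open>x = (p - 1) * ln 2\<close> together with \<open>ln 2 \<ge> 1 / 2\<close>.\<close>

lemma half_le_inverse_powr:
  fixes p :: real
  assumes "1 \<le> p"
  shows "1 / 2 \<le> (1 / (p + 1)) powr (1 / p)"
proof -
  have "((1 / 2) powr p) powr (1 / p) \<le> (1 / (p + 1)) powr (1 / p)"
  proof (rule powr_mono2)
    have "(p - 1) * (1 / 2) \<le> (p - 1) * ln 2"
      using ln2_ge_two_thirds assms by (intro mult_left_mono) auto
    also have "\<dots> + 1 \<le> 2 powr (p - 1)"
      using exp_ge_add_one_self[of "(p - 1) * ln 2"] by (simp add: powr_def add.commute)
    finally have "1 + p \<le> 2 powr p"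
      by (simp add: powr_diff diff_divide_distrib)
    then show "(1 / 2) powr p \<le> 1 / (p + 1)"
      using assms by (simp add: powr_divide field_simps)
  qed (use assms in auto)
  then show ?thesis
    using assms by (simp add: powr_powr)
qed

theorem theorem2p7:
  fixes I :: "real set" and f :: "real \<Rightarrow> real" and a b p q :: real
  assumes "is_interval I"
    and "times_differentiable_on 3 f (interior I)"
    and "a \<in> interior I" and "b \<in> interior I" and "a < b"
    and "(deriv ^^ 3) f absolutely_integrable_on {a..b}"
    and "p > 1" and "q = p / (p - 1)"
    and "quasi_convex_on {a..b} (\<lambda>x. \<bar>(deriv ^^ 3) f x\<bar> powr (p / (p - 1)))"
  shows "\<bar>f ((a + b) / 2) - 1 / (b - a) * integral {a..b} f
            + (b - a) / 24 * (deriv f b - deriv f a)\<bar>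
         \<le> (b - a) ^ 3 / 96 * (1 / (p + 1)) powr (1 / p)
            * (max (\<bar>(deriv ^^ 3) f a\<bar> powr q) (\<bar>(deriv ^^ 3) f b\<bar> powr q)) powr (1 / q)"
proof -
  let ?g = "\<lambda>x. \<bar>(deriv ^^ 3) f x\<bar>"
  define M where "M = max (?g a powr q) (?g b powr q) powr (1 / q)"
  have "q > 0"
    using assms(7,8) by simp
  have sub: "{a..b} \<subseteq> interior I"
    using closed_segment_subset[OF assms(3,4)] assms(1,5)
    by (simp add: closed_segment_eq_real_ivl is_interval_convex)
  have "?g x \<le> M" if "x \<in> {a..b}" for x
  proof -
    \<comment> \<open>The segment runs from \<open>b\<close> to \<open>a\<close> so that its
      parameter is the weight of \<open>a\<close>, as in \<open>quasi_convex_on_def\<close>.\<close>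
    have "x \<in> closed_segment b a"
      using that \<open>a < b\<close> by (simp add: closed_segment_eq_real_ivl)
    then obtain t where "t \<in> {0..1}" "x = t * a + (1 - t) * b"
      by (auto simp: in_segment algebra_simps)
    then have "?g x powr q \<le> max (?g a powr q) (?g b powr q)"
      using assms(5,8,9) unfolding quasi_convex_on_def by auto
    then have "(?g x powr q) powr (1 / q) \<le> M"
      unfolding M_def using \<open>q > 0\<close> by (intro powr_mono2) auto
    then show ?thesis
      using \<open>q > 0\<close> by (simp add: powr_powr)
  qed
  then have "\<bar>f ((a + b) / 2) - 1 / (b - a) * integral {a..b} f + (b - a) / 24 * (deriv f b - deriv f a)\<bar>
      \<le> (b - a) ^ 3 / 192 * M"
    using midpoint_corrected_bound[OF open_interior sub assms(5,2)] by blast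
  \<comment> \<open>This isolates the factor \<open>1 / 2\<close>, to be replaced by the larger
    \<open>p\<close>-dependent factor.\<close>
  also have "\<dots> = (b - a) ^ 3 / 96 * (1 / 2) * M"
    by simp
  also have "\<dots> \<le> (b - a) ^ 3 / 96 * (1 / (p + 1)) powr (1 / p) * M"
    using half_le_inverse_powr[of p] assms(5,7)
    by (intro mult_right_mono mult_left_mono) (auto simp: M_def)
  finally show ?thesis
    by (simp add: M_def)
qed

end
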